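(* Let $r,l\in\mathbb{N}$, $\mathbf{m}=(m_1,\dots,m_r)\in\mathbb{N}^r$, $m=m_1+\cdots+m_r$, $\mathbf{f}\in\mathbb{C}^r$, $\mathbf{p}=(p_1,\dots,p_l)\in\mathbb{N}^l$, $p=p_1+\cdots+p_l$, $\mathbf{h}\in\mathbb{C}^l$ and $\alpha,\beta,d,e\in\mathbb{C}$, where $\alpha$ or $d$ is a negative integer. Then $$ F\left(\begin{matrix}\alpha,\;\beta-m,\;\boldsymbol\eta+1,\;d,\;\mathbf{h}+\mathbf{p}\\2\beta,\;\boldsymbol\eta,\;e,\;\mathbf{h}\end{matrix}\,\Big|\,2\right) =\frac{\Gamma(e-\alpha-d)\,\Gamma(e)}{\Gamma(e-\alpha)\,(1+d+\alpha-e)_{p}\,(\mathbf{h})_{\mathbf{p}}}\, F\left(\begin{matrix}\Delta(\alpha,2),\;\Delta(d,2),\;\mathbf{f}+\mathbf{m}\\\beta+1/2,\;\Delta(1+d+\alpha+p-e,2),\;\mathbf{f}\end{matrix}\;\vdots\;Y_p(2,2)\;\Big|\,1\right), $$ where $\boldsymbol\eta$ is the vector of the $2m$ zeros of the polynomial $$ R_{2m}(t)=\sum_{k=0}^{m}\frac{(-1)^k(\mathbf{f})_{\mathbf{m}}(t)_{2k}(\beta-m-t)_{m-k}}{4^k\,k!}\;{}_{r+1}F_{r}\left(\begin{matrix}-k,\mathbf{f}+\mathbf{m}\\\mathbf{f}\end{matrix}\,\Big|\,1\right) $$ and $Y_p(2,2)$ denotes the polynomial $t\mapsto Y_p(2,2;t)$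 (defined in the context) with $\lambda=-\alpha$.
   Context: Notation: $(a)_n=\Gamma(a+n)/\Gamma(a)$; for vectors, $(\mathbf{a})_n=\prod_j(a_j)_n$, $(\mathbf{h})_{\mathbf{p}}=\prod_i(h_i)_{p_i}$, and $\mathbf{a}+\beta$ means adding $\beta$ to each component. $\Delta(a,2)=(a/2,(a+1)/2)$. For a polynomial $P$, $$F\left(\begin{matrix}\mathbf{a}\\\mathbf{b}\end{matrix}\;\vdots\;P\;\Big|\;x\right)=\sum_{n\ge0}\frac{(\mathbf{a})_n}{(\mathbf{b})_n\,n!}P(n)x^n,$$ with $P\equiv1$ when omitted; an omitted argument means $x=1$. Zeros are listed with multiplicity. Standing convention: lower parameters are never non-positive integers, and all Gamma functions are defined and all denominators non-zero. $$ Y_p(u,v;t)=\frac{(\mathbf{h}-d)_{\mathbf{p}}}{\Gamma(e-d)}\sum_{j=0}^{p}\frac{(d-e+1)_{j}}{j!}\,F\left(\begin{matrix}-j,1-\mathbf{h}+d\\1-\mathbf{h}+d-\mathbf{p}\end{matrix}\right)(ut+d)_{j}\,(vt+d-e-\lambda+j+1)_{p-j}. $$ *)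

theory Defs
  imports "HOL-Analysis.Analysis" "HOL-Computational_Algebra.Computational_Algebra"
begin

text \<open>Vectors are lists. The symbol \<open>(a)\<^sub>n\<close> is \<^const>\<open>pochhammer\<close>, which agrees with
  \<open>\<Gamma>(a + n) / \<Gamma>(a)\<close> off the poles and is its usual extension to non-positive integers \<open>a\<close>;
  that extension is needed, since terminating series have such upper parameters.\<close>

definition vec_poch :: "complex list \<Rightarrow> nat \<Rightarrow> complex" where
  "vec_poch as n = (\<Prod>a\<leftarrow>as. pochhammer a n)"

definition vec_poch_multi :: "complex list \<Rightarrow> nat list \<Rightarrow> complex" where
  "vec_poch_multi hs ps = (\<Prod>(h, p)\<leftarrow>zip hs ps. pochhammer h p)"

definition vec_add :: "complex list \<Rightarrow> nat list \<Rightarrow> complex list" where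
  "vec_add hs ps = map2 (\<lambda>h p. h + of_nat p) hs ps"

definition vec_sub :: "complex list \<Rightarrow> nat list \<Rightarrow> complex list" where
  "vec_sub hs ps = map2 (\<lambda>h p. h - of_nat p) hs ps"

definition Delta2 :: "complex \<Rightarrow> complex list" where
  "Delta2 a = [a / 2, (a + 1) / 2]"

definition hypF :: "complex list \<Rightarrow> complex list \<Rightarrow> complex poly \<Rightarrow> complex \<Rightarrow> complex" where
  "hypF as bs P x =
     (\<Sum>n. vec_poch as n / (vec_poch bs n * fact n) * poly P (of_nat n) * x ^ n)"

definition lower_ok :: "complex list \<Rightarrow> bool" where
  "lower_ok bs \<longleftrightarrow> (\<forall>b\<in>set bs. b \<notin> \<int>\<^sub>\<le>\<^sub>0)"

text \<open>In the next two definitions \<^const>\<open>pochhammer\<close> is applied to linear polynomials in \<open>t\<close>: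
  \<open>[:c, u:]\<close> is \<open>u * t + c\<close>. The evaluation lemmas give the formulas as functions of \<open>t\<close>.\<close>

definition Ypoly :: "complex list \<Rightarrow> nat list \<Rightarrow> complex \<Rightarrow> complex \<Rightarrow> complex \<Rightarrow>
    complex \<Rightarrow> complex \<Rightarrow> complex poly" where
  "Ypoly hs ps d e lam u v =
     (let p = sum_list ps; hs' = map (\<lambda>h. 1 - h + d) hs in
      smult (vec_poch_multi (map (\<lambda>h. h - d) hs) ps / Gamma (e - d))
        (\<Sum>j=0..p.
           smult (pochhammer (d - e + 1) j / fact j *
                  hypF (- of_nat j # hs') (vec_sub hs' ps) 1 1)
             (pochhammer [:d, u:] j *
              pochhammer [:d - e - lam + of_nat j + 1, v:] (p - j))))"

definition Rpoly :: "complex list \<Rightarrow> nat list \<Rightarrow> complex \<Rightarrow> complex poly" where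
  "Rpoly fs ms \<beta> =
     (let m = sum_list ms in
      \<Sum>k=0..m.
        smult ((-1) ^ k * vec_poch_multi fs ms / (4 ^ k * fact k) *
               hypF (- of_nat k # vec_add fs ms) fs 1 1)
          (pochhammer [:0, 1:] (2 * k) *
           pochhammer [:\<beta> - of_nat m, -1:] (m - k)))"

lemma poly_pochhammer:
  "poly (pochhammer P n) (t :: complex) = pochhammer (poly P t) n"
  by (simp add: pochhammer_prod poly_prod)

lemma poly_Ypoly:
  assumes "p = sum_list ps"
  shows "poly (Ypoly hs ps d e lam u v) t =
    vec_poch_multi (map (\<lambda>h. h - d) hs) ps / Gamma (e - d) *
      (\<Sum>j=0..p. pochhammer (d - e + 1) j / fact j *
         hypF (- of_nat j # map (\<lambda>h. 1 - h + d) hs) (vec_sub (map (\<lambda>h. 1 - h + d) hs) ps) 1 1 *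
         pochhammer (u * t + d) j *
         pochhammer (v * t + d - e - lam + of_nat j + 1) (p - j))"
  unfolding Ypoly_def Let_def assms
  by (simp add: poly_sum poly_pochhammer algebra_simps)

lemma poly_Rpoly:
  assumes "m = sum_list ms"
  shows "poly (Rpoly fs ms \<beta>) t =
    (\<Sum>k=0..m. (-1) ^ k * vec_poch_multi fs ms * pochhammer t (2 * k) *
         pochhammer (\<beta> - of_nat m - t) (m - k) / (4 ^ k * fact k) *
         hypF (- of_nat k # vec_add fs ms) fs 1 1)"
  unfolding Rpoly_def Let_def assms
  by (simp add: poly_sum poly_pochhammer algebra_simps)

end

(* Since the eta_i are the zeros of R, prod (eta_i + 1)_n / (eta_i)_n = R(-n) / R(0), and
   (beta - m)_n (beta - m + n)_{m-k} = (beta - m)_m (beta)_{n-k} turns the n-th term of the left side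
   into a sum over k. Expanding the inner hypergeometric value in g_j = (f + m)_j / (f)_j and summing
   over k gives a Gegenbauer polynomial at 1, which collapses the coefficient of g_j to
   1 / (4^j j! (beta + 1/2)_j (n - 2j)!). After exchanging the sums, what remains for each j is a
   terminating sum over n >= 2j with the polynomial factor (h + n)_p. The Newton expansion of that
   factor in the basis (d + n)_i makes it a combination of Gauss sums, which is Y_p(2,2;j). *)
theory Submission
  imports Defs
begin

text \<open>Two facts make the exchange of sums possible. Up to a constant,
  \<open>(f + m)_j / (f)_j\<close> is a polynomial in \<open>j\<close> of degree \<open>m\<close>,
  so its alternating differences of order above \<open>m\<close> vanish. The sum over
  \<open>k\<close> in R, which stops at \<open>m\<close>, can therefore be continued until
  \<open>(-n)_{2k}\<close> cuts it off, and only this full range gives a Gegenbauer polynomial.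
  Moreover \<open>(\<alpha>)_n (d)_n\<close> is zero beyond a common bound \<open>T\<close>,
  whichever parameter terminates, so all sums are finite and argument 2 raises no question of
  convergence. The obstacle is degenerate parameters. The Gauss sums carry
  \<open>Gamma (e - \<alpha> - d - (2j + i))\<close>, so \<open>e - \<alpha> - d\<close> has to
  avoid every integer; this is extracted from the non-vanishing conditions on the right side. The
  arguments \<open>2t\<close> in Y come from the shift \<open>n = 2t + s\<close>, and because this
  shift is even the signs of the reflected Gamma factors cancel.\<close>

subsection \<open>Alternating differences and Newton series\<close>

text \<open>Equal to \<open>(-1)\<^sup>k\<close> times the \<open>k\<close>-th forward difference of \<open>y\<close> at \<open>0\<close>; the hypergeometric
  values inside \<^const>\<open>Rpoly\<close> and \<^const>\<open>Ypoly\<close> are of this form.\<close>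

definition alt_diff :: "nat \<Rightarrow> (nat \<Rightarrow> complex) \<Rightarrow> complex" where
  "alt_diff k y = (\<Sum>i\<le>k. (-1) ^ i * of_nat (k choose i) * y i)"

text \<open>Write \<open>q(x) = a + x q'(x)\<close>. The constant is killed by the alternating
  binomial sum, and \<open>(k+1 choose i+1) (i+1) = (k+1) (k choose i)\<close> turns the rest into
  \<open>-(k+1)\<close> times the difference of order \<open>k\<close> of
  \<open>s(x) = q'(x + 1)\<close>, which has the same top coefficient as \<open>q'\<close>.\<close>

lemma alt_diff_poly:
  assumes "degree q \<le> k"
  shows "alt_diff k (\<lambda>i. poly q (of_nat i)) = (-1) ^ k * fact k * coeff q k"
  using assms
proof (induction k arbitrary: q)
  case 0
  then show ?case by (simp add: alt_diff_def poly_0_coeff_0)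
next
  case (Suc k)
  obtain a q' where q: "q = pCons a q'"
    by (cases q)
  define s where "s = q' \<circ>\<^sub>p [:1, 1:]"
  have deg: "degree q' \<le> k"
    using Suc.prems q by (auto split: if_splits)
  have s_deg: "degree s = degree q'"
    by (simp add: s_def degree_pcompose)
  have s_coeff: "coeff s k = coeff q' k"
  proof (cases "degree q' = k")
    case True
    have "lead_coeff s = lead_coeff q'"
      unfolding s_def by (subst lead_coeff_comp) simp_all
    then show ?thesis
      using True s_deg by simp
  next
    case False
    then show ?thesis
      using deg s_deg by (simp add: coeff_eq_0)
  qed
  have "alt_diff (Suc k) (\<lambda>i. poly q (of_nat i)) =
      a * (\<Sum>i\<le>Suc k. (-1) ^ i * of_nat (Suc k choose i)) +
      (\<Sum>i\<le>Suc k. (-1) ^ i * of_nat (Suc k choose i) * (of_nat i * poly q' (of_nat i)))"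
    unfolding alt_diff_def q poly_pCons sum_distrib_left sum.distrib[symmetric]
    by (intro sum.cong refl) (simp add: algebra_simps)
  also have "(\<Sum>i\<le>Suc k. (-1) ^ i * of_nat (Suc k choose i)) = (0 :: complex)"
    by (rule choose_alternating_sum) simp
  also have "(\<Sum>i\<le>Suc k. (-1) ^ i * of_nat (Suc k choose i) * (of_nat i * poly q' (of_nat i))) =
      (\<Sum>i\<le>k. (-1) ^ Suc i * of_nat (Suc k choose Suc i) * (of_nat (Suc i) * poly q' (of_nat (Suc i))))"
    by (subst sum.atMost_Suc_shift) simp
  also have "\<dots> = (\<Sum>i\<le>k. - of_nat (Suc k) * ((-1) ^ i * of_nat (k choose i) * poly s (of_nat i)))"
  proof (intro sum.cong refl)
    fix i
    have "of_nat (Suc k choose Suc i) * of_nat (Suc i) = (of_nat (Suc k) * of_nat (k choose i) :: complex)"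
      by (metis Suc_times_binomial mult.commute of_nat_mult)
    moreover have "poly q' (of_nat (Suc i)) = poly s (of_nat i)"
      by (simp add: s_def poly_pcompose)
    ultimately show "(-1) ^ Suc i * of_nat (Suc k choose Suc i) * (of_nat (Suc i) * poly q' (of_nat (Suc i))) =
        - of_nat (Suc k) * ((-1) ^ i * of_nat (k choose i) * poly s (of_nat i))"
      by (metis (no_types, opaque_lifting) mult.assoc mult.commute mult_minus1 power_Suc mult_minus_left)
  qed
  also have "\<dots> = - of_nat (Suc k) * alt_diff k (\<lambda>i. poly s (of_nat i))"
    by (simp only: alt_diff_def sum_distrib_left)
  also have "alt_diff k (\<lambda>i. poly s (of_nat i)) = (-1) ^ k * fact k * coeff s k"
    by (rule Suc.IH) (use deg s_deg in simp)
  finally show ?case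
    using s_coeff by (simp add: q algebra_simps)
qed

text \<open>The polynomial \<open>(h + x)_p\<close> in \<open>x\<close>. Up to constants its values
  at \<open>n\<close> are the quotients \<open>(h + p)_n / (h)_n\<close>, and its values at
  \<open>-d - i\<close> are the quotients inside Y; with \<open>f\<close> and \<open>ms\<close> it
  likewise gives the quotients inside R.\<close>

definition rising_poly :: "complex list \<Rightarrow> nat list \<Rightarrow> complex poly" where
  "rising_poly hs ps = (\<Prod>(h, p)\<leftarrow>zip hs ps. pochhammer [:h, 1:] p)"

lemma monic_pochhammer:
  "degree (pochhammer [:h, 1 :: complex:] p) = p \<and> lead_coeff (pochhammer [:h, 1:] p) = 1"
proof (induction p)
  case (Suc p)
  have *: "[:h, 1:] + of_nat p = [:h + of_nat p, 1 :: complex:]"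
    by (simp add: of_nat_poly)
  have nz: "pochhammer [:h, 1:] p \<noteq> 0"
    using Suc by auto
  have "degree (pochhammer [:h, 1:] (Suc p)) = Suc p"
    unfolding pochhammer_Suc * using Suc nz by (subst degree_mult_eq) auto
  moreover have "lead_coeff (pochhammer [:h, 1:] (Suc p)) = 1"
    unfolding pochhammer_Suc * lead_coeff_mult conjunct2[OF Suc] by simp
  ultimately show ?case by blast
qed simp

lemma monic_rising_poly:
  assumes "length hs = length ps"
  shows "degree (rising_poly hs ps) = sum_list ps \<and> lead_coeff (rising_poly hs ps) = 1"
  using assms
proof (induction hs ps rule: list_induct2)
  case (Cons h hs p ps)
  have eq: "rising_poly (h # hs) (p # ps) = pochhammer [:h, 1:] p * rising_poly hs ps"
    by (simp add: rising_poly_def)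
  have nz: "rising_poly hs ps \<noteq> 0" "pochhammer [:h, 1:] p \<noteq> 0"
    using Cons monic_pochhammer[of h p] by auto
  have "lead_coeff (rising_poly (h # hs) (p # ps)) = 1"
    unfolding eq lead_coeff_mult conjunct2[OF Cons.IH] conjunct2[OF monic_pochhammer] by simp
  moreover have "degree (rising_poly (h # hs) (p # ps)) = sum_list (p # ps)"
    unfolding eq using nz Cons.IH monic_pochhammer[of h p] by (simp add: degree_mult_eq)
  ultimately show ?case by blast
qed (simp add: rising_poly_def)

lemma poly_rising_poly:
  "poly (rising_poly hs ps) x = vec_poch_multi (map (\<lambda>h. h + x) hs) ps"
  unfolding rising_poly_def vec_poch_multi_def
  by (induction hs ps rule: list_induct2') (simp_all add: poly_pochhammer)

section \<open>Pochhammer quotients as polynomial values\<close>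

lemma lower_ok_pochhammer:
  assumes "lower_ok bs" "b \<in> set bs"
  shows "pochhammer b n \<noteq> 0"
  using assms unfolding lower_ok_def pochhammer_eq_0_iff by auto

lemma vec_poch_nonzero: "lower_ok bs \<Longrightarrow> vec_poch bs n \<noteq> 0"
  unfolding vec_poch_def using lower_ok_pochhammer by (auto simp: prod_list_zero_iff)

text \<open>Joins the identity for the head of a parameter list to the induction hypothesis for its
  tail.\<close>

lemma mult_eq_interchange:
  fixes a b c d :: complex
  assumes "a * b = c * d" "a' * b' = c' * d'"
  shows "(a * a') * (b * b') = (c * c') * (d * d')"
proof -
  have "(a * a') * (b * b') = (a * b) * (a' * b')"
    by (simp only: mult_ac)
  also have "\<dots> = (c * c') * (d * d')"
    unfolding assms by (simp only: mult_ac)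
  finally show ?thesis .
qed

text \<open>In each component, \<open>(x + k)_n (x)_k\<close> and \<open>(x + n)_k (x)_n\<close> are
  the two ways of splitting \<open>(x)_{n+k}\<close>.\<close>

lemma vec_poch_add_ratio:
  assumes "length f = length ms" "lower_ok f"
  shows "vec_poch (vec_add f ms) n / vec_poch f n = poly (rising_poly f ms) (of_nat n) / vec_poch_multi f ms"
    and "vec_poch_multi f ms \<noteq> 0"
proof -
  have "vec_poch (vec_add f ms) n * vec_poch_multi f ms =
        vec_poch_multi (map (\<lambda>h. h + of_nat n) f) ms * vec_poch f n \<and> vec_poch_multi f ms \<noteq> 0"
    using assms
  proof (induction f ms rule: list_induct2)
    case (Cons x xs k ks)
    have "pochhammer (x + of_nat k) n * pochhammer x k = pochhammer (x + of_nat n) k * pochhammer x n"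
      by (metis add.commute mult.commute pochhammer_product')
    moreover have IH: "vec_poch (vec_add xs ks) n * vec_poch_multi xs ks =
        vec_poch_multi (map (\<lambda>h. h + of_nat n) xs) ks * vec_poch xs n" "vec_poch_multi xs ks \<noteq> 0"
      using Cons by (auto simp: lower_ok_def)
    ultimately have "(pochhammer (x + of_nat k) n * vec_poch (vec_add xs ks) n) *
          (pochhammer x k * vec_poch_multi xs ks) =
        (pochhammer (x + of_nat n) k * vec_poch_multi (map (\<lambda>h. h + of_nat n) xs) ks) *
          (pochhammer x n * vec_poch xs n)"
      by (intro mult_eq_interchange)
    then have "vec_poch (vec_add (x # xs) (k # ks)) n * vec_poch_multi (x # xs) (k # ks) =
        vec_poch_multi (map (\<lambda>h. h + of_nat n) (x # xs)) (k # ks) * vec_poch (x # xs) n"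
      by (simp only: vec_poch_def vec_add_def vec_poch_multi_def list.map zip_Cons_Cons prod_list.Cons case_prod_conv)
    moreover have "pochhammer x k \<noteq> 0"
      using Cons.prems by (rule lower_ok_pochhammer) simp
    ultimately show ?case
      using IH(2) by (simp add: vec_poch_multi_def)
  qed (simp add: vec_poch_def vec_add_def vec_poch_multi_def)
  then show "vec_poch_multi f ms \<noteq> 0"
    "vec_poch (vec_add f ms) n / vec_poch f n = poly (rising_poly f ms) (of_nat n) / vec_poch_multi f ms"
    using vec_poch_nonzero[OF assms(2), of n] by (simp_all add: field_simps poly_rising_poly)
qed

lemma pochhammer_reflect: "pochhammer (x - of_nat n) n = (-1) ^ n * pochhammer (1 - x) n" for x :: complex
  using pochhammer_minus'[of "x - 1" n] by (simp add: algebra_simps)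

text \<open>Split \<open>(x - i)_{i+p}\<close> after \<open>i\<close> and after \<open>p\<close>
  factors; reflecting the two blocks of length \<open>i\<close> produces the same sign
  \<open>(-1)^i\<close> on both sides.\<close>

lemma pochhammer_shift_down:
  "pochhammer (1 - x) i * pochhammer x p = pochhammer (x - of_nat i) p * pochhammer (1 - x - of_nat p) i"
  for x :: complex
proof -
  have "pochhammer (x - of_nat i) (i + p) = pochhammer (x - of_nat i) i * pochhammer x p"
    by (simp add: pochhammer_product')
  moreover have "pochhammer (x - of_nat i) (p + i) =
      pochhammer (x - of_nat i) p * pochhammer (x + of_nat p - of_nat i) i"
    unfolding pochhammer_product' by (simp add: algebra_simps)
  moreover have "pochhammer (x + of_nat p - of_nat i) i = (-1) ^ i * pochhammer (1 - x - of_nat p) i"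
    using pochhammer_reflect[of "x + of_nat p" i] by (simp add: algebra_simps)
  ultimately have "pochhammer (x - of_nat i) i * pochhammer x p =
      pochhammer (x - of_nat i) p * ((-1) ^ i * pochhammer (1 - x - of_nat p) i)"
    by (metis add.commute)
  then show ?thesis
    by (simp add: pochhammer_reflect)
qed

lemma vec_poch_sub_ratio:
  assumes "length h = length ps" "lower_ok (vec_sub (map (\<lambda>x. 1 - x + d) h) ps)"
  shows "vec_poch_multi (map (\<lambda>x. x - d) h) ps *
      (vec_poch (map (\<lambda>x. 1 - x + d) h) i / vec_poch (vec_sub (map (\<lambda>x. 1 - x + d) h) ps) i) =
      poly (rising_poly h ps) (- d - of_nat i)"
proof -
  have "vec_poch_multi (map (\<lambda>x. x - d) h) ps * vec_poch (map (\<lambda>x. 1 - x + d) h) i =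
     vec_poch_multi (map (\<lambda>x. x + (- d - of_nat i)) h) ps * vec_poch (vec_sub (map (\<lambda>x. 1 - x + d) h) ps) i"
    using assms(1)
  proof (induction h ps rule: list_induct2)
    case (Cons x xs k ks)
    have "pochhammer (x - d) k * pochhammer (1 - x + d) i =
        pochhammer (x + (- d - of_nat i)) k * pochhammer (1 - x + d - of_nat k) i"
      using pochhammer_shift_down[of "x - d" i k] by (simp add: algebra_simps)
    from mult_eq_interchange[OF this Cons.IH] show ?case
      by (simp only: vec_poch_def vec_sub_def vec_poch_multi_def list.map zip_Cons_Cons prod_list.Cons case_prod_conv)
  qed (simp add: vec_poch_def vec_sub_def vec_poch_multi_def)
  then show ?thesis
    using vec_poch_nonzero[OF assms(2), of i] by (simp add: field_simps poly_rising_poly)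
qed

section \<open>Terminating series and Newton expansion\<close>

lemma hypF_terminating:
  assumes "\<And>n. n > T \<Longrightarrow> vec_poch as n = 0"
  shows "hypF as bs P x = (\<Sum>n\<le>T. vec_poch as n / (vec_poch bs n * fact n) * poly P (of_nat n) * x ^ n)"
  unfolding hypF_def using assms by (intro suminf_finite) auto

text \<open>The upper parameter \<open>-k\<close> supplies the weights, since
  \<open>(-k)_i / i! = (-1)^i (k choose i)\<close>.\<close>

lemma hypF_alt_diff:
  "hypF (- of_nat k # as) bs 1 1 = alt_diff k (\<lambda>i. vec_poch as i / vec_poch bs i)"
proof -
  have "vec_poch (- of_nat k # as) n = 0" if "n > k" for n
    using that by (simp add: vec_poch_def pochhammer_of_nat_eq_0_lemma)
  then have "hypF (- of_nat k # as) bs 1 1 =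
      (\<Sum>n\<le>k. vec_poch (- of_nat k # as) n / (vec_poch bs n * fact n) * poly 1 (of_nat n) * 1 ^ n)"
    by (rule hypF_terminating)
  moreover have binom: "pochhammer (- of_nat k) i / fact i = (-1) ^ i * (of_nat (k choose i) :: complex)" for i
  proof -
    have "of_nat (k choose i) = (-1) ^ i * pochhammer (- of_nat k) i / (fact i :: complex)"
      using gbinomial_pochhammer[of "of_nat k :: complex" i] by (simp add: binomial_gbinomial)
    then show ?thesis
      by (simp flip: power_mult_distrib)
  qed
  moreover have "vec_poch (- of_nat k # as) i / (vec_poch bs i * fact i) =
      (-1) ^ i * of_nat (k choose i) * (vec_poch as i / vec_poch bs i)" for i
  proof -
    have "vec_poch (- of_nat k # as) i / (vec_poch bs i * fact i) =
        (pochhammer (- of_nat k) i / fact i) * (vec_poch as i / vec_poch bs i)"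
      by (simp add: vec_poch_def)
    then show ?thesis
      by (simp only: binom)
  qed
  ultimately show ?thesis
    by (simp add: alt_diff_def)
qed

lemma newton_series:
  assumes "degree q \<le> p"
  shows "poly q x = (\<Sum>j\<le>p. pochhammer x j / fact j * alt_diff j (\<lambda>i. poly q (- of_nat i)))"
proof -
  have "\<exists>c. \<forall>x. poly q x = (\<Sum>j\<le>p. c j * pochhammer x j)"
    using assms
  proof (induction p arbitrary: q)
    case 0
    then have "poly q x = coeff q 0 * pochhammer x 0" for x
      by (auto elim!: degree_eq_zeroE)
    then show ?case by (intro exI[of _ "\<lambda>_. coeff q 0"]) simp
  next
    case (Suc p)
    define u where "u = pochhammer [:0, 1 :: complex:] (Suc p)"
    define a where "a = coeff q (Suc p)"
    have u: "degree u = Suc p" "coeff u (Suc p) = 1"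
      using monic_pochhammer[of 0 "Suc p"] by (auto simp: u_def)
    have "coeff (q - smult a u) i = 0" if "i > p" for i
    proof (cases "i = Suc p")
      case True
      then show ?thesis using u by (simp add: a_def)
    next
      case False
      then show ?thesis using that Suc.prems u
        by (simp add: coeff_eq_0)
    qed
    then have "degree (q - smult a u) \<le> p"
      by (intro degree_le) blast
    then obtain c where c: "\<And>x. poly (q - smult a u) x = (\<Sum>j\<le>p. c j * pochhammer x j)"
      using Suc.IH by blast
    have "poly q x = (\<Sum>j\<le>Suc p. (c(Suc p := a)) j * pochhammer x j)" for x
    proof -
      have "poly q x = poly (q - smult a u) x + a * pochhammer x (Suc p)"
        unfolding u_def by (simp add: poly_pochhammer del: pochhammer_Suc)
      then show ?thesis
        unfolding c by simp
    qed
    then show ?case by blast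
  qed
  then obtain c where c: "\<And>x. poly q x = (\<Sum>j\<le>p. c j * pochhammer x j)" by blast
  \<comment> \<open>Differences at the nodes \<open>-i\<close> are dual to the basis
    \<open>(x)_l\<close>. For \<open>l < j\<close> the degree is too small; for
    \<open>l \<ge> j\<close> the value \<open>(-i)_l\<close> vanishes at all nodes
    \<open>i < l\<close>, so only \<open>i = l = j\<close> can contribute.\<close>
  have D: "alt_diff j (\<lambda>i. pochhammer (- of_nat i) l) = (if l = j then fact j else 0)" for j l
  proof (cases "l < j")
    case True
    let ?w = "pochhammer [:0, 1:] l \<circ>\<^sub>p [:0, -1 :: complex:]"
    have deg: "degree ?w = l"
      using monic_pochhammer[of 0 l] by (simp add: degree_pcompose)
    have "alt_diff j (\<lambda>i. poly ?w (of_nat i)) = (-1) ^ j * fact j * coeff ?w j"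
      by (rule alt_diff_poly) (use deg True in simp)
    then show ?thesis
      using True deg by (simp add: poly_pcompose poly_pochhammer coeff_eq_0)
  next
    case False
    have "alt_diff j (\<lambda>i. pochhammer (- of_nat i) l) =
      (\<Sum>i\<le>j. if i = l then (-1) ^ i * of_nat (j choose i) * pochhammer (- of_nat i) l else 0)"
      unfolding alt_diff_def using False by (intro sum.cong refl) (auto simp: pochhammer_of_nat_eq_0_lemma)
    also have "\<dots> = (if l = j then fact j else 0)"
      using False by (auto simp: pochhammer_same simp flip: power_mult_distrib)
    finally show ?thesis .
  qed
  have "alt_diff j (\<lambda>i. poly q (- of_nat i)) = fact j * c j" if "j \<le> p" for j
  proof -
    have "alt_diff j (\<lambda>i. poly q (- of_nat i)) = (\<Sum>l\<le>p. c l * alt_diff j (\<lambda>i. pochhammer (- of_nat i) l))"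
      unfolding alt_diff_def c sum_distrib_left
      by (subst sum.swap) (intro sum.cong refl, simp add: algebra_simps)
    then show ?thesis
      using that by (simp add: D if_distrib cong: if_cong)
  qed
  then have "(\<Sum>j\<le>p. pochhammer x j / fact j * alt_diff j (\<lambda>i. poly q (- of_nat i))) =
      (\<Sum>j\<le>p. c j * pochhammer x j)"
    by (intro sum.cong) simp_all
  then show ?thesis
    using c[of x] by simp
qed

subsection \<open>The Gegenbauer polynomial at 1\<close>

text \<open>\<open>\<Sum>\<^sub>i geg_term N l i x\<^sup>N\<^sup>-\<^sup>2\<^sup>i\<close> is the Gegenbauer polynomial \<open>C\<^sub>N\<close> of parameter \<open>l\<close>. The recurrence below is
  \<open>N C\<^sub>N(l) = 2 l (x C\<^sub>N\<^sub>-\<^sub>1(l + 1) - C\<^sub>N\<^sub>-\<^sub>2(l + 1))\<close>, which holds term by term and, unlike a reduction to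
  Chu-Vandermonde, for every \<open>l\<close>.\<close>

definition geg_term :: "nat \<Rightarrow> complex \<Rightarrow> nat \<Rightarrow> complex" where
  "geg_term N l i = (if 2 * i \<le> N then
     (-1) ^ i * pochhammer l (N - i) * 2 ^ (N - 2 * i) / (fact i * fact (N - 2 * i)) else 0)"

lemma geg_term_0:
  "of_nat (Suc (Suc N)) * geg_term (Suc (Suc N)) l 0 = 2 * l * geg_term (Suc N) (l + 1) 0"
  unfolding geg_term_def
  by (simp add: pochhammer_rec[of l "Suc N"] fact_Suc[of "Suc N"] field_simps del: of_nat_Suc fact_Suc)

lemma geg_term_Suc:
  "of_nat (Suc (Suc N)) * geg_term (Suc (Suc N)) l (Suc i) =
    2 * l * (geg_term (Suc N) (l + 1) (Suc i) - geg_term N (l + 1) i)"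
proof (cases "2 * i \<le> N")
  case False
  then show ?thesis by (simp add: geg_term_def)
next
  case True
  then obtain M where N: "N = 2 * i + M"
    using le_Suc_ex by blast
  define P where "P = pochhammer (l + 1) (i + M)"
  have P: "pochhammer l (Suc (i + M)) = l * P"
    by (simp add: P_def pochhammer_rec)
  \<comment> \<open>With \<open>N + 2 = 2 (i + 1) + M\<close>, the two terms on the right supply the
    summands \<open>M\<close> and \<open>2 (i + 1)\<close> over a common denominator. For
    \<open>M = 0\<close> the first of them lies outside the range of \<open>geg_term\<close> and is
    zero.\<close>
  show ?thesis
  proof (cases M)
    case 0
    have of_nat_N: "of_nat (Suc (Suc N)) = (2 * of_nat (Suc i) :: complex)"
      by (simp add: N 0)
    have E1: "geg_term (Suc (Suc N)) l (Suc i) = - ((-1) ^ i * (l * P) / (of_nat (Suc i) * fact i))"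
      using P 0 unfolding N geg_term_def by simp
    have E2: "geg_term (Suc N) (l + 1) (Suc i) = 0"
      unfolding N 0 geg_term_def by simp
    have E3: "geg_term N (l + 1) i = (-1) ^ i * P / fact i"
      unfolding N geg_term_def by (simp add: P_def 0)
    show ?thesis
      unfolding of_nat_N E1 E2 E3 by (simp del: of_nat_Suc)
  next
    case (Suc M')
    have E1: "geg_term (Suc (Suc N)) l (Suc i) =
        - ((-1) ^ i * (l * P) * (2 * 2 ^ M') / (of_nat (Suc i) * fact i * (of_nat (Suc M') * fact M')))"
      using P unfolding N geg_term_def by (simp add: add.commute Suc)
    have E2: "geg_term (Suc N) (l + 1) (Suc i) = - ((-1) ^ i * P * 2 ^ M' / (of_nat (Suc i) * fact i * fact M'))"
      unfolding N Suc geg_term_def by (simp add: P_def Suc add.commute)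
    have E3: "geg_term N (l + 1) i = (-1) ^ i * P * (2 * 2 ^ M') / (fact i * (of_nat (Suc M') * fact M'))"
      unfolding N geg_term_def by (simp add: P_def Suc add.commute)
    have of_nat_N: "of_nat (Suc (Suc N)) = (2 * of_nat (Suc i) + of_nat (Suc M') :: complex)"
      by (simp add: N Suc)
    show ?thesis
      unfolding of_nat_N E1 E2 E3 by (simp add: field_simps del: of_nat_Suc)
  qed
qed

text \<open>The recurrence lowers the degree but raises the parameter, so \<open>l\<close> stays
  arbitrary in the induction. The two known values combine because
  \<open>(2l + 2 + N) - (N + 1) = 2l + 1\<close>.\<close>

lemma gegenbauer_at_1: "(\<Sum>i\<le>N. geg_term N l i) = pochhammer (2 * l) N / fact N"
proof (induction N arbitrary: l rule: induct_nat_012)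
  case 0
  then show ?case by (simp add: geg_term_def)
next
  case 1
  then show ?case by (simp add: geg_term_def)
next
  case (ge2 N)
  have ext: "(\<Sum>i\<le>Suc N. geg_term N (l + 1) i) = (\<Sum>i\<le>N. geg_term N (l + 1) i)"
    by (simp add: geg_term_def)
  have "geg_term (Suc N) (l + 1) (Suc (Suc N)) = 0"
    by (simp add: geg_term_def)
  then have ext': "(\<Sum>i\<le>Suc N. geg_term (Suc N) (l + 1) (Suc i)) + geg_term (Suc N) (l + 1) 0 =
      (\<Sum>i\<le>Suc N. geg_term (Suc N) (l + 1) i)"
    using sum.atMost_Suc_shift[of "geg_term (Suc N) (l + 1)" "Suc N"] by simp
  have "of_nat (Suc (Suc N)) * (\<Sum>i\<le>Suc (Suc N). geg_term (Suc (Suc N)) l i) =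
      2 * l * geg_term (Suc N) (l + 1) 0 +
      (\<Sum>i\<le>Suc N. 2 * l * (geg_term (Suc N) (l + 1) (Suc i) - geg_term N (l + 1) i))"
    by (simp only: sum.atMost_Suc_shift[of _ "Suc N"] distrib_left geg_term_0 sum_distrib_left geg_term_Suc)
  also have "\<dots> = 2 * l * ((\<Sum>i\<le>Suc N. geg_term (Suc N) (l + 1) i) - (\<Sum>i\<le>N. geg_term N (l + 1) i))"
    unfolding ext[symmetric] ext'[symmetric]
    by (simp only: sum_distrib_left[symmetric] sum_subtractf) (simp only: algebra_simps)
  also have "\<dots> = 2 * l * (pochhammer (2 * l + 2) (Suc N) / fact (Suc N) - pochhammer (2 * l + 2) N / fact N)"
    using ge2(1)[of "l + 1"] ge2(2)[of "l + 1"] by (simp only: distrib_left mult_1_right)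
  also have "\<dots> = 2 * l * (2 * l + 1) * pochhammer (2 * l + 2) N / fact (Suc N)"
    by (simp add: pochhammer_Suc divide_simps del: of_nat_Suc) (simp add: algebra_simps)
  also have "\<dots> = pochhammer (2 * l) (Suc (Suc N)) / fact (Suc N)"
    by (simp add: pochhammer_rec algebra_simps)
  finally show ?case
    unfolding fact_Suc[of "Suc N"] by (simp add: field_simps del: fact_Suc of_nat_Suc sum.atMost_Suc)
qed

subsection \<open>Terminating Gauss sums and the polynomial \<open>Y\<close>\<close>

text \<open>The reciprocal Gamma function is used because \<open>c - b\<close> may be a non-positive integer.\<close>

lemma chu_vandermonde_Gamma:
  assumes "c \<notin> \<int>\<^sub>\<le>\<^sub>0" "c - a - b \<notin> \<int>\<^sub>\<le>\<^sub>0" "a = - of_nat K" "K \<le> L"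
  shows "(\<Sum>s\<le>L. pochhammer a s * pochhammer b s / (pochhammer c s * fact s)) =
    Gamma c * Gamma (c - a - b) * rGamma (c - a) * rGamma (c - b :: complex)"
proof -
  have "(\<Sum>s\<le>L. pochhammer a s * pochhammer b s / (pochhammer c s * fact s)) =
        (\<Sum>s\<le>K. pochhammer a s * pochhammer b s / (pochhammer c s * fact s))"
    using assms(3,4) by (intro sum.mono_neutral_right) (auto simp: pochhammer_of_nat_eq_0_lemma)
  also have "\<dots> = pochhammer (c - b) K / pochhammer c K"
  proof -
    have "\<forall>i\<in>{0..<K}. c \<noteq> - of_nat i"
      using assms(1) by auto
    from Vandermonde_pochhammer[OF this, of b] show ?thesis
      by (simp add: assms(3) atMost_atLeast0 mult.commute)
  qed
  also have "\<dots> = Gamma c * Gamma (c - a - b) * rGamma (c - a) * rGamma (c - b)"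
  proof -
    have "rGamma (c - b) = pochhammer (c - b) K * rGamma (c - a - b)"
      using pochhammer_rGamma[of "c - b" K] by (simp add: assms(3) algebra_simps)
    moreover have "rGamma (c - a - b) \<noteq> 0" "rGamma c \<noteq> 0"
      using assms(1,2) by (simp_all add: rGamma_eq_zero_iff)
    moreover have "rGamma c = pochhammer c K * rGamma (c - a)"
      using pochhammer_rGamma[of c K] by (simp add: assms(3))
    ultimately show ?thesis
      by (simp add: Gamma_def field_simps)
  qed
  finally show ?thesis .
qed

text \<open>In Gamma form the value is symmetric in \<open>a\<close> and \<open>b\<close>, so either
  of them may terminate the sum. The bound \<open>L\<close> is kept apart from the terminating index
  \<open>K\<close> so that one summation range serves both cases.\<close>

lemma gauss_sum:
  assumes "c \<notin> \<int>\<^sub>\<le>\<^sub>0" "c - a - b \<notin> \<int>\<^sub>\<le>\<^sub>0" "a = - of_nat K \<or> b = - of_nat K" "K \<le> L"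
  shows "(\<Sum>s\<le>L. pochhammer a s * pochhammer b s / (pochhammer c s * fact s)) =
    Gamma c * Gamma (c - a - b) * rGamma (c - a) * rGamma (c - b :: complex)"
  using assms(3)
proof
  assume "a = - of_nat K"
  then show ?thesis
    using assms chu_vandermonde_Gamma by blast
next
  assume b: "b = - of_nat K"
  have eq: "c - b - a = c - a - b"
    by simp
  from chu_vandermonde_Gamma[OF assms(1) _ b assms(4), of a] assms(2) show ?thesis
    unfolding eq by (simp add: mult_ac)
qed

text \<open>Pulling out the first factors of each symbol leaves a Gauss sum with parameters
  \<open>\<alpha> + k\<close>, \<open>d + k + j\<close> and \<open>e + k\<close>; the shift
  \<open>k\<close> drops out of \<open>c - a\<close> and \<open>c - b\<close>.\<close>

lemma shifted_gauss_sum: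
  fixes \<alpha> d e :: complex
  assumes "e \<notin> \<int>\<^sub>\<le>\<^sub>0" "e - \<alpha> - d \<notin> \<int>" "\<alpha> = - of_nat T \<or> d = - of_nat T" "k \<le> T"
  shows "(\<Sum>s\<le>T - k. pochhammer \<alpha> (k + s) * pochhammer d (k + j + s) / (pochhammer e (k + s) * fact s)) =
    pochhammer \<alpha> k * pochhammer d (k + j) * Gamma e * Gamma (e - \<alpha> - d - of_nat (k + j)) *
      rGamma (e - \<alpha>) * rGamma (e - d - of_nat j)"
proof (cases "pochhammer \<alpha> k * pochhammer d (k + j) = 0")
  \<comment> \<open>This covers \<open>d = -T\<close> with \<open>k + j > T\<close>, where
    \<open>d + k + j\<close> is positive and would not terminate the Gauss sum.\<close>
  case True
  then show ?thesis
    by (auto simp: pochhammer_product')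
next
  case False
  let ?a = "\<alpha> + of_nat k" and ?b = "d + of_nat (k + j)" and ?c = "e + of_nat k"
  obtain K where K: "?a = - of_nat K \<or> ?b = - of_nat K" "K \<le> T - k"
    using assms(3)
  proof
    assume a: "\<alpha> = - of_nat T"
    show ?thesis
      using a assms(4) by (intro that[of "T - k"]) (simp_all add: of_nat_diff)
  next
    assume d: "d = - of_nat T"
    then have "k + j \<le> T"
      using False pochhammer_of_nat_eq_0_lemma[of T "k + j"] by (auto simp: not_le[symmetric])
    then show ?thesis
      using d by (intro that[of "T - (k + j)"]) (simp_all add: of_nat_diff)
  qed
  have e: "pochhammer e k \<noteq> 0"
    using assms(1) by (auto simp: pochhammer_eq_0_iff)
  have c: "?c \<notin> \<int>\<^sub>\<le>\<^sub>0"
    using assms(1) nonpos_Ints_diff_Nats[of ?c "of_nat k"] by auto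
  have w: "?c - ?a - ?b \<notin> \<int>\<^sub>\<le>\<^sub>0"
  proof
    assume "?c - ?a - ?b \<in> \<int>\<^sub>\<le>\<^sub>0"
    then have "?c - ?a - ?b + of_nat (k + j) \<in> \<int>"
      by (intro Ints_add nonpos_Ints_Int Ints_of_nat)
    then show False
      using assms(2) by (simp add: algebra_simps)
  qed
  have "(\<Sum>s\<le>T - k. pochhammer \<alpha> (k + s) * pochhammer d (k + j + s) / (pochhammer e (k + s) * fact s)) =
    pochhammer \<alpha> k * pochhammer d (k + j) / pochhammer e k *
    (\<Sum>s\<le>T - k. pochhammer ?a s * pochhammer ?b s / (pochhammer ?c s * fact s))"
    unfolding sum_distrib_left by (intro sum.cong refl) (simp add: pochhammer_product' mult_ac)
  also have "(\<Sum>s\<le>T - k. pochhammer ?a s * pochhammer ?b s / (pochhammer ?c s * fact s)) =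
    Gamma ?c * Gamma (?c - ?a - ?b) * rGamma (?c - ?a) * rGamma (?c - ?b)"
    by (rule gauss_sum[OF c w K])
  also have "Gamma ?c = Gamma e * pochhammer e k"
    using pochhammer_Gamma[OF assms(1), of k] assms(1) by (simp add: Gamma_eq_zero_iff)
  finally show ?thesis
    using e by (simp add: algebra_simps)
qed

text \<open>The basis \<open>(d + n)_j\<close> is chosen because it is absorbed by an upper
  parameter: \<open>(d)_n (d + n)_j = (d)_{n+j}\<close>.\<close>

lemma inner_sum:
  fixes \<alpha> d e :: complex
  assumes "degree q \<le> p" "e \<notin> \<int>\<^sub>\<le>\<^sub>0" "e - \<alpha> - d \<notin> \<int>"
    and "\<alpha> = - of_nat T \<or> d = - of_nat T" "k \<le> T" "even k"
  shows "(\<Sum>s\<le>T - k. pochhammer \<alpha> (k + s) * pochhammer d (k + s) / (pochhammer e (k + s) * fact s) *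
            poly q (of_nat (k + s))) =
    pochhammer \<alpha> k * pochhammer d k * Gamma e * Gamma (e - \<alpha> - d) * rGamma (e - \<alpha>) * rGamma (e - d) *
    (\<Sum>j\<le>p. pochhammer (d - e + 1) j / fact j * alt_diff j (\<lambda>i. poly q (- d - of_nat i)) *
       pochhammer (d + of_nat k) j / pochhammer (1 + d + \<alpha> - e) (k + j))"
proof -
  define D where "D = (\<lambda>j. alt_diff j (\<lambda>i. poly q (- d - of_nat i)))"
  define w where "w = e - \<alpha> - d"
  have newton: "poly q (of_nat n) = (\<Sum>j\<le>p. pochhammer (d + of_nat n) j / fact j * D j)" for n
  proof -
    \<comment> \<open>Expanding \<open>q(x - d)\<close> at \<open>x = d + n\<close> moves the nodes
      to \<open>-d - i\<close>, where the differences are those that occur in Y.\<close>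
    have "degree (q \<circ>\<^sub>p [:- d, 1:]) \<le> p"
      using assms(1) by (simp add: degree_pcompose)
    from newton_series[OF this, of "d + of_nat n"] show ?thesis
      by (simp add: poly_pcompose D_def)
  qed
  have Gamma_w: "Gamma (w - of_nat n) = (-1) ^ n * Gamma w / pochhammer (1 - w) n" for n
  proof -
    have "rGamma (w - of_nat n) = (-1) ^ n * pochhammer (1 - w) n * rGamma w"
      using pochhammer_rGamma[of "w - of_nat n" n] by (simp add: pochhammer_reflect)
    then show ?thesis
      by (cases "even n") (simp_all add: Gamma_def field_simps)
  qed
  have rGamma_ed: "rGamma (e - d - of_nat j) = (-1) ^ j * pochhammer (d - e + 1) j * rGamma (e - d)" for j
  proof -
    have "1 - (e - d) = d - e + 1"
      by simp
    with pochhammer_rGamma[of "e - d - of_nat j" j] show ?thesis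
      by (simp only: pochhammer_reflect diff_add_cancel)
  qed
  have "(\<Sum>s\<le>T - k. pochhammer \<alpha> (k + s) * pochhammer d (k + s) / (pochhammer e (k + s) * fact s) *
            poly q (of_nat (k + s))) =
    (\<Sum>s\<le>T - k. \<Sum>j\<le>p. D j / fact j *
      (pochhammer \<alpha> (k + s) * pochhammer d (k + j + s) / (pochhammer e (k + s) * fact s)))"
  proof (intro sum.cong refl)
    fix s
    have d: "pochhammer d (k + j + s) = pochhammer d (k + s) * pochhammer (d + of_nat (k + s)) j" for j
      by (metis add.assoc add.commute pochhammer_product')
    show "pochhammer \<alpha> (k + s) * pochhammer d (k + s) / (pochhammer e (k + s) * fact s) * poly q (of_nat (k + s)) =
      (\<Sum>j\<le>p. D j / fact j *
        (pochhammer \<alpha> (k + s) * pochhammer d (k + j + s) / (pochhammer e (k + s) * fact s)))"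
      unfolding newton d sum_distrib_left by (intro sum.cong refl) (simp add: mult_ac)
  qed
  also have "\<dots> = (\<Sum>j\<le>p. D j / fact j *
      (pochhammer \<alpha> k * pochhammer d (k + j) * Gamma e * Gamma (w - of_nat (k + j)) *
      rGamma (e - \<alpha>) * rGamma (e - d - of_nat j)))"
    unfolding w_def shifted_gauss_sum[OF assms(2-5), symmetric] sum_distrib_left by (rule sum.swap)
  also have "\<dots> = (\<Sum>j\<le>p. pochhammer \<alpha> k * pochhammer d k * Gamma e * Gamma w * rGamma (e - \<alpha>) * rGamma (e - d) *
    (pochhammer (d - e + 1) j / fact j * D j * pochhammer (d + of_nat k) j / pochhammer (1 - w) (k + j)))"
  proof (intro sum.cong refl)
    fix j
    \<comment> \<open>The signs come from \<open>Gamma_w\<close> and \<open>rGamma_ed\<close>; their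
      product is \<open>(-1)^k\<close>, which is why \<open>k\<close> must be even.\<close>
    have "(-1) ^ j * (-1) ^ (k + j) = (1 :: complex)"
      using assms(6) by (simp add: power_add flip: power_mult_distrib)
    then have "Gamma (w - of_nat (k + j)) * rGamma (e - d - of_nat j) =
        Gamma w / pochhammer (1 - w) (k + j) * (pochhammer (d - e + 1) j * rGamma (e - d))"
      unfolding Gamma_w rGamma_ed by (simp add: mult.assoc mult.left_commute)
    then have "D j / fact j *
      (pochhammer \<alpha> k * pochhammer d (k + j) * Gamma e * rGamma (e - \<alpha>) *
       (Gamma (w - of_nat (k + j)) * rGamma (e - d - of_nat j))) =
      pochhammer \<alpha> k * pochhammer d k * Gamma e * Gamma w * rGamma (e - \<alpha>) * rGamma (e - d) *
      (pochhammer (d - e + 1) j / fact j * D j * pochhammer (d + of_nat k) j / pochhammer (1 - w) (k + j))"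
      by (simp add: pochhammer_product' mult_ac)
    then show "D j / fact j *
      (pochhammer \<alpha> k * pochhammer d (k + j) * Gamma e * Gamma (w - of_nat (k + j)) *
      rGamma (e - \<alpha>) * rGamma (e - d - of_nat j)) =
      pochhammer \<alpha> k * pochhammer d k * Gamma e * Gamma w * rGamma (e - \<alpha>) * rGamma (e - d) *
      (pochhammer (d - e + 1) j / fact j * D j * pochhammer (d + of_nat k) j / pochhammer (1 - w) (k + j))"
      by (simp only: mult_ac)
  qed
  finally show ?thesis
    by (simp add: sum_distrib_left w_def D_def add.commute add_diff_eq diff_diff_eq2)
qed

lemma pochhammer_nonInt_nonzero: "z \<notin> \<int> \<Longrightarrow> pochhammer (z :: complex) n \<noteq> 0"
  by (auto simp: pochhammer_eq_0_iff)

text \<open>With \<open>c = 1 + d + \<alpha> - e\<close>, the second Pochhammer factor in Y is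
  \<open>(c + 2t + j)_{p-j} = (c)_{2t+p} / (c)_{2t+j}\<close>. So Y is the sum from
  \<open>inner_sum\<close> brought to the common denominator
  \<open>(c)_{2t+p} = (c)_p (c + p)_{2t}\<close>, divided by \<open>Gamma (e - d)\<close>.\<close>

lemma inner_sum_Ypoly:
  fixes \<alpha> d e :: complex
  assumes "length h = length ps" "lower_ok (vec_sub (map (\<lambda>x. 1 - x + d) h) ps)"
    and "e \<notin> \<int>\<^sub>\<le>\<^sub>0" "e - d \<notin> \<int>\<^sub>\<le>\<^sub>0" "e - \<alpha> - d \<notin> \<int>"
    and "\<alpha> = - of_nat T \<or> d = - of_nat T" "2 * t \<le> T" "p = sum_list ps"
  shows "(\<Sum>s\<le>T - 2 * t. pochhammer \<alpha> (2 * t + s) * pochhammer d (2 * t + s) /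
            (pochhammer e (2 * t + s) * fact s) * poly (rising_poly h ps) (of_nat (2 * t + s))) =
    pochhammer \<alpha> (2 * t) * pochhammer d (2 * t) * (Gamma e * Gamma (e - \<alpha> - d) / Gamma (e - \<alpha>)) *
    poly (Ypoly h ps d e (- \<alpha>) 2 2) (of_nat t) /
      (pochhammer (1 + d + \<alpha> - e) p * pochhammer (1 + d + \<alpha> + of_nat p - e) (2 * t))"
proof -
  let ?c = "1 + d + \<alpha> - e"
  let ?M = "vec_poch_multi (map (\<lambda>h. h - d) h) ps"
  define D where "D = (\<lambda>j. alt_diff j (\<lambda>i. poly (rising_poly h ps) (- d - of_nat i)))"
  have "?c \<notin> \<int>"
  proof
    assume "?c \<in> \<int>"
    then have "1 - ?c \<in> \<int>"
      using Ints_diff Ints_1 by blast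
    moreover have "1 - ?c = e - \<alpha> - d"
      by simp
    ultimately show False
      using assms(5) by simp
  qed
  note nz = pochhammer_nonInt_nonzero[OF this]
  have M: "?M * hypF (- of_nat j # map (\<lambda>h. 1 - h + d) h) (vec_sub (map (\<lambda>h. 1 - h + d) h) ps) 1 1 = D j" for j
    unfolding hypF_alt_diff D_def vec_poch_sub_ratio[OF assms(1,2), symmetric]
    by (simp add: alt_diff_def sum_distrib_left mult_ac)
  have "poly (Ypoly h ps d e (- \<alpha>) 2 2) (of_nat t) =
     (\<Sum>j\<le>p. pochhammer (d - e + 1) j / fact j * D j * pochhammer (d + of_nat (2 * t)) j *
        pochhammer (?c + of_nat (2 * t + j)) (p - j)) / Gamma (e - d)"
    unfolding poly_Ypoly[OF assms(8)] M[symmetric] atMost_atLeast0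
    by (simp add: sum_distrib_left sum_divide_distrib algebra_simps)
  also have "\<dots> = (\<Sum>j\<le>p. pochhammer (d - e + 1) j / fact j * D j * pochhammer (d + of_nat (2 * t)) j /
       pochhammer ?c (2 * t + j)) * pochhammer ?c (2 * t + p) / Gamma (e - d)"
    unfolding sum_distrib_right
  proof (intro arg_cong2[of _ _ _ _ "(/)"] sum.cong refl)
    fix j assume "j \<in> {..p}"
    then have "pochhammer ?c (2 * t + p) = pochhammer ?c (2 * t + j) * pochhammer (?c + of_nat (2 * t + j)) (p - j)"
      using pochhammer_product[of "2 * t + j" "2 * t + p" ?c] by simp
    then show "pochhammer (d - e + 1) j / fact j * D j * pochhammer (d + of_nat (2 * t)) j *
        pochhammer (?c + of_nat (2 * t + j)) (p - j) =
      pochhammer (d - e + 1) j / fact j * D j * pochhammer (d + of_nat (2 * t)) j /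
       pochhammer ?c (2 * t + j) * pochhammer ?c (2 * t + p)"
      using nz[of "2 * t + j"] by simp
  qed
  finally have Y: "(\<Sum>j\<le>p. pochhammer (d - e + 1) j / fact j * D j * pochhammer (d + of_nat (2 * t)) j /
       pochhammer ?c (2 * t + j)) =
     poly (Ypoly h ps d e (- \<alpha>) 2 2) (of_nat t) * Gamma (e - d) / pochhammer ?c (p + 2 * t)"
    using nz[of "p + 2 * t"] assms(4) by (simp add: Gamma_eq_zero_iff add.commute)
  have c: "pochhammer ?c (p + 2 * t) = pochhammer ?c p * pochhammer (1 + d + \<alpha> + of_nat p - e) (2 * t)"
    unfolding pochhammer_product' by (simp add: algebra_simps)
  have G: "rGamma (e - d) * Gamma (e - d) = 1"
    using assms(4) by (simp add: Gamma_def rGamma_eq_zero_iff)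
  have deg: "degree (rising_poly h ps) \<le> p"
    using monic_rising_poly[OF assms(1)] assms(8) by simp
  have "even (2 * t)"
    by simp
  have D: "alt_diff j (\<lambda>i. poly (rising_poly h ps) (- d - of_nat i)) = D j" for j
    by (simp add: D_def)
  from inner_sum[OF deg assms(3,5,6,7) \<open>even (2 * t)\<close>, unfolded D Y]
  have "(\<Sum>s\<le>T - 2 * t. pochhammer \<alpha> (2 * t + s) * pochhammer d (2 * t + s) /
            (pochhammer e (2 * t + s) * fact s) * poly (rising_poly h ps) (of_nat (2 * t + s))) =
    pochhammer \<alpha> (2 * t) * pochhammer d (2 * t) * Gamma e * Gamma (e - \<alpha> - d) * rGamma (e - \<alpha>) *
      poly (Ypoly h ps d e (- \<alpha>) 2 2) (of_nat t) * (rGamma (e - d) * Gamma (e - d)) / pochhammer ?c (p + 2 * t)"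
    by (simp add: mult_ac)
  then show ?thesis
    unfolding G c by (simp add: rGamma_inverse_Gamma divide_simps)
qed

subsection \<open>The polynomial \<open>R\<close> and the transformation\<close>

lemma sum_shift_if:
  fixes F :: "nat \<Rightarrow> complex"
  shows "(\<Sum>n\<le>T. if k \<le> n then F n else 0) = (if k \<le> T then \<Sum>s\<le>T - k. F (k + s) else 0)"
proof (cases "k \<le> T")
  case True
  have "(\<Sum>n\<le>T. if k \<le> n then F n else 0) = (\<Sum>n\<in>{k..T}. F n)"
    by (intro sum.mono_neutral_cong_right) auto
  also have "\<dots> = (\<Sum>s\<le>T - k. F (k + s))"
    by (intro sum.reindex_bij_witness[of _ "\<lambda>s. k + s" "\<lambda>n. n - k"]) (use True in auto)
  finally show ?thesis
    using True by simp
qed simp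

lemma pochhammer_minus_of_nat:
  "pochhammer (- of_nat n) k = (if k \<le> n then (-1) ^ k * fact n / fact (n - k) else 0 :: complex)"
proof (cases "k \<le> n")
  case True
  have "(fact n :: complex) = fact (n - k) * pochhammer (of_nat n - of_nat k + 1) k"
    using pochhammer_product[of "n - k" n "1 :: complex"] True
    by (simp add: pochhammer_fact of_nat_diff add.commute)
  then show ?thesis
    using True by (simp add: pochhammer_minus)
qed (simp add: pochhammer_of_nat_eq_0_lemma)

text \<open>Put \<open>k = j + i\<close> and \<open>N = n - 2j\<close>. Then
  \<open>(\<beta>)_{n-k} = (\<beta>)_j (\<beta> + j)_{N-i}\<close> and
  \<open>(k choose j) / k! = 1 / (j! i!)\<close>, which leaves the Gegenbauer sum of degree
  \<open>N\<close> and parameter \<open>\<beta> + j\<close>.\<close>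

lemma gegenbauer_coefficient:
  fixes \<beta> :: complex
  assumes "2 * \<beta> \<notin> \<int>\<^sub>\<le>\<^sub>0" "2 * j \<le> n"
  shows "(\<Sum>k\<le>n. if 2 * k \<le> n then (-1) ^ k * pochhammer \<beta> (n - k) / (4 ^ k * fact k * fact (n - 2 * k)) *
            ((-1) ^ j * of_nat (k choose j)) else 0) =
         pochhammer (2 * \<beta>) n / (2 ^ n * 4 ^ j * fact j * pochhammer (\<beta> + 1/2) j * fact (n - 2 * j))"
proof -
  define N where "N = n - 2 * j"
  have n: "n = 2 * j + N"
    using assms(2) by (simp add: N_def)
  define F where "F = (\<lambda>k. if 2 * k \<le> n then (-1) ^ k * pochhammer \<beta> (n - k) / (4 ^ k * fact k * fact (n - 2 * k)) *
            ((-1) ^ j * of_nat (k choose j)) else 0)"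
  have F: "F (j + i) = pochhammer \<beta> j / (4 ^ j * fact j * 2 ^ N) * geg_term N (\<beta> + of_nat j) i" for i
  proof (cases "2 * i \<le> N")
    case False
    then show ?thesis by (simp add: F_def geg_term_def n)
  next
    case True
    then obtain M where N: "N = 2 * i + M"
      using le_Suc_ex by blast
    have "n - (j + i) = j + (N - i)" "n - 2 * (j + i) = M" "N - 2 * i = M"
      using N n by auto
    moreover have "of_nat (j + i choose j) / fact (j + i) = (1 / (fact j * fact i) :: complex)"
      by (simp add: binomial_fact)
    moreover have "(-1) ^ (j + i) * (-1) ^ j = ((-1) ^ i :: complex)"
      by (simp add: power_add flip: power_mult_distrib)
    moreover have "2 ^ M / 2 ^ N = (1 / 4 ^ i :: complex)"
      by (simp add: N power_add power_mult)
    moreover have "F (j + i) = ((-1) ^ (j + i) * (-1) ^ j) * pochhammer \<beta> (n - (j + i)) / (4 ^ j * 4 ^ i) *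
        (of_nat (j + i choose j) / fact (j + i)) / fact (n - 2 * (j + i))"
      using True by (simp add: F_def n power_add)
    moreover have "pochhammer \<beta> j / (4 ^ j * fact j * 2 ^ N) * geg_term N (\<beta> + of_nat j) i =
        (2 ^ M / 2 ^ N) * (-1) ^ i * pochhammer \<beta> (j + (N - i)) / (4 ^ j * (fact j * fact i) * fact M)"
      using True \<open>N - 2 * i = M\<close> unfolding pochhammer_product'
      by (simp add: geg_term_def) (simp add: mult_ac)
    ultimately show ?thesis
      by simp
  qed
  have "(\<Sum>k\<le>n. F k) = (\<Sum>k\<le>n. if j \<le> k then F k else 0)"
    by (intro sum.cong refl) (auto simp: F_def not_le binomial_eq_0)
  also have "\<dots> = (\<Sum>i\<le>n - j. F (j + i))"
    using assms(2) by (simp add: sum_shift_if)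
  also have "\<dots> = (\<Sum>i\<le>N. F (j + i))"
    by (intro sum.mono_neutral_right) (auto simp: F_def n)
  also have "\<dots> = pochhammer \<beta> j / (4 ^ j * fact j * 2 ^ N) * (pochhammer (2 * (\<beta> + of_nat j)) N / fact N)"
    unfolding F by (simp only: gegenbauer_at_1 flip: sum_distrib_left)
  also have "\<dots> = pochhammer (2 * \<beta>) n / (2 ^ n * 4 ^ j * fact j * pochhammer (\<beta> + 1/2) j * fact N)"
  proof -
    have dbl: "pochhammer (2 * \<beta>) (2 * j) = 4 ^ j * pochhammer \<beta> j * pochhammer (\<beta> + 1/2) j"
      using pochhammer_double[of \<beta> j] by (simp add: power_mult)
    \<comment> \<open>Duplication passes non-vanishing from \<open>(2\<beta>)_{2j}\<close> to its
      factor \<open>(\<beta> + 1/2)_j\<close>.\<close>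
    have "pochhammer (2 * \<beta>) (2 * j) \<noteq> 0"
      using assms(1) by (auto simp: pochhammer_eq_0_iff)
    then have "pochhammer (\<beta> + 1/2) j \<noteq> 0"
      using dbl by auto
    moreover have "pochhammer (2 * \<beta>) n = pochhammer (2 * \<beta>) (2 * j) * pochhammer (2 * (\<beta> + of_nat j)) N"
      unfolding n pochhammer_product' by (simp add: algebra_simps)
    moreover have "(2 :: complex) ^ n = 4 ^ j * 2 ^ N"
      by (simp add: n power_add power_mult)
    ultimately show ?thesis
      unfolding dbl by simp
  qed
  finally show ?thesis
    by (simp only: F_def N_def)
qed

section \<open>Zeros and values of R\<close>

text \<open>Each quotient telescopes: \<open>(a + 1)_n / (a)_n = (a + n) / a\<close>, a linear
  factor of \<open>R\<close> at \<open>-n\<close> over the same factor at \<open>0\<close>. The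
  leading coefficient cancels.\<close>

lemma vec_poch_roots_ratio:
  assumes "R \<noteq> 0" "mset \<eta> = proots R" "lower_ok \<eta>"
  shows "vec_poch (map (\<lambda>x. x + 1) \<eta>) n / vec_poch \<eta> n = poly R (- of_nat n) / poly R 0"
proof -
  have poly_roots: "poly (\<Prod>a\<leftarrow>\<eta>. [:- a, 1:]) x = (\<Prod>a\<leftarrow>\<eta>. x - a)" for x
    by (induction \<eta>) (simp_all add: algebra_simps)
  have poly_R: "poly R x = lead_coeff R * (\<Prod>a\<leftarrow>\<eta>. x - a)" for x
  proof -
    have "R = smult (lead_coeff R) (\<Prod>a\<in>#mset \<eta>. [:- a, 1:])"
      unfolding assms(2) by (rule complex_poly_decompose_multiset[symmetric])
    then have "poly R x = poly (smult (lead_coeff R) (\<Prod>a\<leftarrow>\<eta>. [:- a, 1:])) x"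
      by (metis mset_map prod_mset_prod_list)
    then show ?thesis
      by (simp add: poly_roots)
  qed
  have diff_0: "(-) 0 = (uminus :: complex \<Rightarrow> complex)"
    by (simp add: fun_eq_iff)
  have "vec_poch (map (\<lambda>x. x + 1) \<eta>) n / vec_poch \<eta> n =
      (\<Prod>a\<leftarrow>\<eta>. - of_nat n - a) / (\<Prod>a\<leftarrow>\<eta>. - a)"
    using assms(3)
  proof (induction \<eta>)
    case (Cons a \<eta>)
    have nz: "pochhammer a n \<noteq> 0" "a \<noteq> 0"
      using lower_ok_pochhammer[OF Cons.prems, of a n] lower_ok_pochhammer[OF Cons.prems, of a 1] by auto
    have "a * pochhammer (a + 1) n = pochhammer a n * (a + of_nat n)"
      by (metis pochhammer_rec pochhammer_Suc)
    then have "pochhammer (a + 1) n / pochhammer a n = (- of_nat n - a) / (- a)"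
      using nz by (simp add: field_simps)
    moreover have "vec_poch (map (\<lambda>x. x + 1) \<eta>) n / vec_poch \<eta> n =
        (\<Prod>a\<leftarrow>\<eta>. - of_nat n - a) / (\<Prod>a\<leftarrow>\<eta>. - a)"
      using Cons by (auto simp: lower_ok_def)
    ultimately show ?case
      unfolding vec_poch_def list.map prod_list.Cons times_divide_times_eq[symmetric] by simp
  qed (simp add: vec_poch_def)
  then show ?thesis
    using assms(1) diff_0 by (simp add: poly_R)
qed

lemma degree_pochhammer_linear: "degree (pochhammer [:b, a :: complex:] n) \<le> n"
proof (induction n)
  case (Suc n)
  have "[:b, a:] + of_nat n = [:b + of_nat n, a:]"
    by (simp add: of_nat_poly)
  then have "degree (pochhammer [:b, a:] (Suc n)) \<le> degree (pochhammer [:b, a:] n) + degree [:b + of_nat n, a:]"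
    unfolding pochhammer_Suc by (metis degree_mult_le)
  also have "\<dots> \<le> n + 1"
    using Suc by (intro add_mono) auto
  finally show ?case by simp
qed simp

lemma hypF_vec_add_alt_diff:
  assumes "length f = length ms" "lower_ok f"
  shows "hypF (- of_nat k # vec_add f ms) f 1 1 =
    alt_diff k (\<lambda>i. poly (rising_poly f ms) (of_nat i)) / vec_poch_multi f ms"
  unfolding hypF_alt_diff vec_poch_add_ratio(1)[OF assms] by (simp add: alt_diff_def sum_divide_distrib)

text \<open>The summand \<open>k\<close> has degree at most \<open>m + k\<close>, so only
  \<open>k = m\<close> reaches degree \<open>2m\<close>. There \<open>(t)_{2m}\<close> is monic and
  its factor is \<open>1 / 4^m\<close>, by the difference of order \<open>m\<close> of a monic
  polynomial of degree \<open>m\<close>.\<close>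

lemma Rpoly_nonzero:
  assumes "length f = length ms" "lower_ok f"
  shows "Rpoly f ms \<beta> \<noteq> 0"
proof -
  define m where "m = sum_list ms"
  define K where "K = (\<lambda>k. (-1) ^ k * vec_poch_multi f ms / (4 ^ k * fact k) *
               hypF (- of_nat k # vec_add f ms) f 1 1)"
  define Q where "Q = (\<lambda>k. pochhammer [:0, 1:] (2 * k) * pochhammer [:\<beta> - of_nat m, -1:] (m - k))"
  have R: "Rpoly f ms \<beta> = (\<Sum>k=0..m. smult (K k) (Q k))"
    by (simp add: Rpoly_def Let_def K_def Q_def m_def)
  have Q: "coeff (Q k) (2 * m) = (if k = m then 1 else 0)" if "k \<le> m" for k
  proof (cases "k = m")
    case True
    then show ?thesis
      using monic_pochhammer[of 0 "2 * m"] by (auto simp: Q_def)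
  next
    case False
    have "degree (Q k) \<le> 2 * k + (m - k)"
      unfolding Q_def by (intro order.trans[OF degree_mult_le] add_mono degree_pochhammer_linear)
    then show ?thesis
      using False that by (simp add: coeff_eq_0)
  qed
  have "coeff (Rpoly f ms \<beta>) (2 * m) = (\<Sum>k=0..m. if k = m then K k else 0)"
    unfolding R coeff_sum by (intro sum.cong refl) (simp add: Q)
  also have "\<dots> = K m"
    by simp
  also have "\<dots> \<noteq> 0"
  proof -
    have "alt_diff m (\<lambda>i. poly (rising_poly f ms) (of_nat i)) = (-1) ^ m * fact m"
      using alt_diff_poly[of "rising_poly f ms" m] monic_rising_poly[OF assms(1)] by (auto simp: m_def)
    then show ?thesis
      using vec_poch_add_ratio(2)[OF assms] by (simp add: K_def hypF_vec_add_alt_diff[OF assms])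
  qed
  finally show ?thesis by auto
qed

text \<open>At \<open>t = 0\<close> the factor \<open>(0)_{2k}\<close> leaves only
  \<open>k = 0\<close>.\<close>

lemma poly_Rpoly_0:
  assumes "length f = length ms" "lower_ok f"
  shows "poly (Rpoly f ms \<beta>) 0 = vec_poch_multi f ms * pochhammer (\<beta> - of_nat (sum_list ms)) (sum_list ms)"
proof -
  have "hypF (- of_nat 0 # vec_add f ms) f 1 1 = 1"
    unfolding hypF_alt_diff by (simp add: alt_diff_def vec_poch_def map_replicate_const)
  then show ?thesis
    unfolding poly_Rpoly[OF refl] by (simp add: pochhammer_0_left sum.atLeast_Suc_atMost)
qed

lemma poly_Rpoly_ratio:
  assumes "length f = length ms" "lower_ok f" "2 * \<beta> \<notin> \<int>\<^sub>\<le>\<^sub>0" "poly (Rpoly f ms \<beta>) 0 \<noteq> 0"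
  shows "2 ^ n / (pochhammer (2 * \<beta>) n * fact n) * pochhammer (\<beta> - of_nat (sum_list ms)) n *
      (poly (Rpoly f ms \<beta>) (- of_nat n) / poly (Rpoly f ms \<beta>) 0) =
    (\<Sum>j\<le>n. if 2 * j \<le> n then vec_poch (vec_add f ms) j / vec_poch f j /
        (4 ^ j * fact j * pochhammer (\<beta> + 1/2) j) / fact (n - 2 * j) else 0)"
proof -
  define m where "m = sum_list ms"
  define g where "g = (\<lambda>j. vec_poch (vec_add f ms) j / vec_poch f j)"
  define fm where "fm = vec_poch_multi f ms"
  have fm: "fm \<noteq> 0"
    using vec_poch_add_ratio(2)[OF assms(1,2)] by (simp add: fm_def)
  have R0: "poly (Rpoly f ms \<beta>) 0 = fm * pochhammer (\<beta> - of_nat m) m"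
    using poly_Rpoly_0[OF assms(1,2)] by (simp add: fm_def m_def)
  have D0: "alt_diff k g = 0" if "k > m" for k
  proof -
    have "alt_diff k (\<lambda>i. poly (rising_poly f ms) (of_nat i)) = 0"
      using alt_diff_poly[of "rising_poly f ms" k] monic_rising_poly[OF assms(1)] that
      by (simp add: m_def coeff_eq_0)
    then show ?thesis
      using hypF_vec_add_alt_diff[OF assms(1,2)] by (simp add: hypF_alt_diff g_def)
  qed
  define U where "U = (\<lambda>k. if 2 * k \<le> n then (-1) ^ k * pochhammer \<beta> (n - k) / (4 ^ k * fact k * fact (n - 2 * k)) else 0)"
  have term_eq: "pochhammer (\<beta> - of_nat m) n * ((-1) ^ k * fm * pochhammer (- of_nat n) (2 * k) *
         pochhammer (\<beta> - of_nat m - (- of_nat n)) (m - k) / (4 ^ k * fact k) * alt_diff k g) =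
      poly (Rpoly f ms \<beta>) 0 * fact n * (U k * alt_diff k g)" if "k \<le> m" for k
  proof (cases "2 * k \<le> n")
    case True
    \<comment> \<open>Both subtractions are exact, as \<open>k \<le> m\<close> and
      \<open>2k \<le> n\<close>, so the two orders agree.\<close>
    have "pochhammer (\<beta> - of_nat m) (n + (m - k)) = pochhammer (\<beta> - of_nat m) (m + (n - k))"
      using True that by (intro arg_cong[of _ _ "pochhammer _"]) simp
    then have "pochhammer (\<beta> - of_nat m) n * pochhammer (\<beta> - of_nat m + of_nat n) (m - k) =
        pochhammer (\<beta> - of_nat m) m * pochhammer \<beta> (n - k)"
      unfolding pochhammer_product' by simp
    then have "(pochhammer (\<beta> - of_nat m) n * pochhammer (\<beta> - of_nat m + of_nat n) (m - k)) *
         ((-1) ^ k * fm * (fact n / fact (n - 2 * k)) / (4 ^ k * fact k) * alt_diff k g) =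
         (pochhammer (\<beta> - of_nat m) m * pochhammer \<beta> (n - k)) *
         ((-1) ^ k * fm * (fact n / fact (n - 2 * k)) / (4 ^ k * fact k) * alt_diff k g)"
      by simp
    then show ?thesis
      using True by (simp add: U_def R0 pochhammer_minus_of_nat mult_ac)
  next
    case False
    then show ?thesis
      by (simp add: U_def pochhammer_minus_of_nat)
  qed
  have "pochhammer (\<beta> - of_nat m) n * poly (Rpoly f ms \<beta>) (- of_nat n) =
      (\<Sum>k\<le>m. poly (Rpoly f ms \<beta>) 0 * fact n * (U k * alt_diff k g))"
    unfolding poly_Rpoly[OF m_def, of f \<beta> "- of_nat n"] hypF_alt_diff g_def[symmetric] fm_def[symmetric] sum_distrib_left atMost_atLeast0
    by (intro sum.cong refl) (use term_eq in auto)
  \<comment> \<open>Differences of order above \<open>m\<close> vanish (\<open>D0\<close>), and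
    \<open>U\<close> vanishes for \<open>2k > n\<close>. The detour over \<open>m + n\<close>
    handles \<open>m < n\<close> and \<open>n < m\<close> alike.\<close>
  also have "(\<Sum>k\<le>m. poly (Rpoly f ms \<beta>) 0 * fact n * (U k * alt_diff k g)) =
      (\<Sum>k\<le>m + n. poly (Rpoly f ms \<beta>) 0 * fact n * (U k * alt_diff k g))"
    by (intro sum.mono_neutral_left) (auto simp: D0)
  also have "\<dots> = (\<Sum>k\<le>n. poly (Rpoly f ms \<beta>) 0 * fact n * (U k * alt_diff k g))"
    by (intro sum.mono_neutral_right) (auto simp: U_def)
  finally have key: "pochhammer (\<beta> - of_nat m) n * poly (Rpoly f ms \<beta>) (- of_nat n) =
      poly (Rpoly f ms \<beta>) 0 * fact n * (\<Sum>k\<le>n. U k * alt_diff k g)"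
    by (simp only: sum_distrib_left)
  have "2 ^ n / (pochhammer (2 * \<beta>) n * fact n) * pochhammer (\<beta> - of_nat m) n *
      (poly (Rpoly f ms \<beta>) (- of_nat n) / poly (Rpoly f ms \<beta>) 0) =
      2 ^ n / (pochhammer (2 * \<beta>) n * fact n) *
      (pochhammer (\<beta> - of_nat m) n * poly (Rpoly f ms \<beta>) (- of_nat n)) / poly (Rpoly f ms \<beta>) 0"
    by simp
  also have "\<dots> = 2 ^ n / pochhammer (2 * \<beta>) n * (\<Sum>k\<le>n. U k * alt_diff k g)"
    unfolding key using assms(4) by simp
  also have "(\<Sum>k\<le>n. U k * alt_diff k g) = (\<Sum>k\<le>n. \<Sum>j\<le>n. g j * (U k * ((-1) ^ j * of_nat (k choose j))))"
  proof (intro sum.cong refl)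
    fix k assume "k \<in> {..n}"
    then have "alt_diff k g = (\<Sum>j\<le>n. (-1) ^ j * of_nat (k choose j) * g j)"
      unfolding alt_diff_def by (intro sum.mono_neutral_left) (auto simp: binomial_eq_0)
    then show "U k * alt_diff k g = (\<Sum>j\<le>n. g j * (U k * ((-1) ^ j * of_nat (k choose j))))"
      by (simp add: sum_distrib_left mult_ac)
  qed
  also have "\<dots> = (\<Sum>j\<le>n. g j * (\<Sum>k\<le>n. U k * ((-1) ^ j * of_nat (k choose j))))"
    unfolding sum_distrib_left by (rule sum.swap)
  also have "2 ^ n / pochhammer (2 * \<beta>) n * \<dots> =
      (\<Sum>j\<le>n. if 2 * j \<le> n then g j / (4 ^ j * fact j * pochhammer (\<beta> + 1/2) j) / fact (n - 2 * j) else 0)"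
    unfolding sum_distrib_left[of "2 ^ n / _"]
  proof (intro sum.cong refl)
    fix j
    show "2 ^ n / pochhammer (2 * \<beta>) n * (g j * (\<Sum>k\<le>n. U k * ((-1) ^ j * of_nat (k choose j)))) =
      (if 2 * j \<le> n then g j / (4 ^ j * fact j * pochhammer (\<beta> + 1/2) j) / fact (n - 2 * j) else 0)"
    proof (cases "2 * j \<le> n")
      case True
      have "pochhammer (2 * \<beta>) n \<noteq> 0"
        using assms(3) by (auto simp: pochhammer_eq_0_iff)
      moreover have "(\<Sum>k\<le>n. U k * ((-1) ^ j * of_nat (k choose j))) =
          pochhammer (2 * \<beta>) n / (2 ^ n * 4 ^ j * fact j * pochhammer (\<beta> + 1/2) j * fact (n - 2 * j))"
        unfolding gegenbauer_coefficient[OF assms(3) True, symmetric] U_def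
        by (intro sum.cong refl) simp
      ultimately show ?thesis
        using True by simp
    next
      case False
      then have "(\<Sum>k\<le>n. U k * ((-1) ^ j * of_nat (k choose j))) = 0"
        by (intro sum.neutral) (auto simp: U_def binomial_eq_0)
      then show ?thesis
        using False by simp
    qed
  qed
  finally show ?thesis
    by (simp only: g_def m_def)
qed

section \<open>Delta parameters and assembly of the identity\<close>

lemma pochhammer_Delta2: "vec_poch (Delta2 a) n = pochhammer a (2 * n) / 4 ^ n"
  using pochhammer_double[of "a / 2" n]
  by (simp add: vec_poch_def Delta2_def power_mult add_divide_distrib)

lemma vec_poch_append: "vec_poch (xs @ ys) n = vec_poch xs n * vec_poch ys n"
  by (simp add: vec_poch_def)

lemma lower_ok_append: "lower_ok (xs @ ys) \<longleftrightarrow> lower_ok xs \<and> lower_ok ys"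
  by (auto simp: lower_ok_def)

lemma lower_ok_Delta2:
  assumes "lower_ok (Delta2 c)"
  shows "c \<noteq> - of_nat n"
proof
  assume c: "c = - of_nat n"
  show False
  proof (cases "even n")
    case True
    then obtain k where "n = 2 * k" ..
    then have "c / 2 = - of_nat k"
      by (simp add: c)
    then show False
      using assms by (simp add: lower_ok_def Delta2_def)
  next
    case False
    then obtain k where "n = 2 * k + 1" ..
    then have "(c + 1) / 2 = - of_nat k"
      by (simp add: c)
    then show False
      using assms by (simp add: lower_ok_def Delta2_def)
  qed
qed

theorem mainTheorem20:
  fixes r l m p :: nat
    and ms ps :: "nat list"
    and f h \<eta> :: "complex list"
    and \<alpha> \<beta> d e :: complex
  assumes "length ms = r" "length f = r" "m = sum_list ms"
    and "length ps = l" "length h = l" "p = sum_list ps"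
    and "(\<exists>N::nat. N > 0 \<and> \<alpha> = - of_nat N) \<or> (\<exists>N::nat. N > 0 \<and> d = - of_nat N)"
    and "mset \<eta> = proots (Rpoly f ms \<beta>)"
    \<comment> \<open>lower parameters are not non-positive integers\<close>
    and "lower_ok ([2 * \<beta>] @ \<eta> @ [e] @ h)"
    and "lower_ok ([\<beta> + 1/2] @ Delta2 (1 + d + \<alpha> + of_nat p - e) @ f)"
    and "lower_ok (vec_sub (map (\<lambda>x. 1 - x + d) h) ps)"
    \<comment> \<open>Gamma functions are defined, denominators do not vanish\<close>
    and "e - \<alpha> - d \<notin> \<int>\<^sub>\<le>\<^sub>0" "e \<notin> \<int>\<^sub>\<le>\<^sub>0" "e - \<alpha> \<notin> \<int>\<^sub>\<le>\<^sub>0" "e - d \<notin> \<int>\<^sub>\<le>\<^sub>0"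
    and "pochhammer (1 + d + \<alpha> - e) p \<noteq> 0" "vec_poch_multi h ps \<noteq> 0"
  shows "hypF ([\<alpha>, \<beta> - of_nat m] @ map (\<lambda>x. x + 1) \<eta> @ [d] @ vec_add h ps)
              ([2 * \<beta>] @ \<eta> @ [e] @ h) 1 2
       = Gamma (e - \<alpha> - d) * Gamma e /
           (Gamma (e - \<alpha>) * pochhammer (1 + d + \<alpha> - e) p * vec_poch_multi h ps) *
         hypF (Delta2 \<alpha> @ Delta2 d @ vec_add f ms)
              ([\<beta> + 1/2] @ Delta2 (1 + d + \<alpha> + of_nat p - e) @ f)
              (Ypoly h ps d e (- \<alpha>) 2 2) 1"
proof -
  obtain T where T: "\<alpha> = - of_nat T \<or> d = - of_nat T"
    using assms(7) by blast
  have lens: "length f = length ms" "length h = length ps"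
    using assms by auto
  have ok: "lower_ok f" "lower_ok \<eta>" "lower_ok h" "2 * \<beta> \<notin> \<int>\<^sub>\<le>\<^sub>0"
    "lower_ok (Delta2 (1 + d + \<alpha> + of_nat p - e))"
    using assms(9,10) by (auto simp: lower_ok_append) (auto simp: lower_ok_def)
  \<comment> \<open>If \<open>e - \<alpha> - d = N + 1\<close>, then
    \<open>c = 1 + d + \<alpha> - e\<close> equals \<open>-N\<close>. For \<open>N < p\<close> this
    makes \<open>(c)_p\<close> zero; otherwise \<open>c + p = -(N - p)\<close> violates the
    condition on the lower Delta parameters.\<close>
  have w: "e - \<alpha> - d \<notin> \<int>"
  proof
    assume "e - \<alpha> - d \<in> \<int>"
    then obtain z where z: "e - \<alpha> - d = of_int z"
      by (rule Ints_cases)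
    then have "z > 0"
      using assms(12) by (metis nonpos_Ints_of_int not_le)
    then obtain N where "z = int (Suc N)"
      by (metis gr0_implies_Suc zero_less_imp_eq_int)
    then have "e - \<alpha> - d = 1 + of_nat N"
      using z by simp
    then have N: "1 + d + \<alpha> - e = - of_nat N"
      by (simp add: algebra_simps)
    show False
    proof (cases "N < p")
      case True
      then show ?thesis
        using assms(16) N by (auto simp: pochhammer_eq_0_iff)
    next
      case False
      then have "1 + d + \<alpha> + of_nat p - e = - of_nat (N - p)"
        using N by (simp add: of_nat_diff algebra_simps)
      then show ?thesis
        using lower_ok_Delta2[OF ok(5)] by blast
    qed
  qed
  have vanish: "pochhammer \<alpha> n * pochhammer d n = 0" if "n > T" for n
    using T that by (auto simp: pochhammer_of_nat_eq_0_lemma)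
  let ?R = "Rpoly f ms \<beta>" and ?H = "rising_poly h ps"
  have Rnz: "?R \<noteq> 0"
    by (rule Rpoly_nonzero[OF lens(1) ok(1)])
  \<comment> \<open>A zero of R at the origin would be an entry of \<open>\<eta>\<close>, hence a
    lower parameter equal to 0.\<close>
  have R0: "poly ?R 0 \<noteq> 0"
  proof
    assume "poly ?R 0 = 0"
    then have "0 \<in> set \<eta>"
      using Rnz assms(8) by (metis mem_Collect_eq set_count_proots set_mset_mset)
    then show False
      using ok(2) by (auto simp: lower_ok_def)
  qed
  define A where "A = (\<lambda>n. pochhammer \<alpha> n * pochhammer d n / pochhammer e n * poly ?H (of_nat n))"
  define g where "g = (\<lambda>j. vec_poch (vec_add f ms) j / vec_poch f j)"
  define c where "c = (\<lambda>j. g j / (4 ^ j * fact j * pochhammer (\<beta> + 1/2) j))"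
  define C where "C = 1 + d + \<alpha> + of_nat p - e"
  define G where "G = Gamma (e - \<alpha> - d) * Gamma e / (Gamma (e - \<alpha>) * pochhammer (1 + d + \<alpha> - e) p * vec_poch_multi h ps)"
  let ?as = "[\<alpha>, \<beta> - of_nat m] @ map (\<lambda>x. x + 1) \<eta> @ [d] @ vec_add h ps"
  let ?bs = "[2 * \<beta>] @ \<eta> @ [e] @ h"
  let ?as' = "Delta2 \<alpha> @ Delta2 d @ vec_add f ms"
  let ?bs' = "[\<beta> + 1/2] @ Delta2 C @ f"
  let ?Y = "Ypoly h ps d e (- \<alpha>) 2 2"
  have "hypF ?as ?bs 1 2 = (\<Sum>n\<le>T. vec_poch ?as n / (vec_poch ?bs n * fact n) * poly 1 (of_nat n) * 2 ^ n)"
  proof (rule hypF_terminating)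
    fix n assume "n > T"
    then show "vec_poch ?as n = 0"
      using vanish by (auto simp: vec_poch_def)
  qed
  \<comment> \<open>The condition \<open>2j \<le> n\<close> is kept as a guard on a square range, so
    the sums can be swapped directly.\<close>
  also have "\<dots> = (\<Sum>n\<le>T. \<Sum>j\<le>T. if 2 * j \<le> n then c j * (A n / fact (n - 2 * j)) / vec_poch_multi h ps else 0)"
  proof (intro sum.cong refl)
    fix n assume n: "n \<in> {..T}"
    have "vec_poch ?as n / (vec_poch ?bs n * fact n) * poly 1 (of_nat n) * 2 ^ n =
      (pochhammer \<alpha> n * pochhammer d n / pochhammer e n) * (vec_poch (vec_add h ps) n / vec_poch h n) *
      (2 ^ n / (pochhammer (2 * \<beta>) n * fact n) * pochhammer (\<beta> - of_nat m) n *
       (vec_poch (map (\<lambda>x. x + 1) \<eta>) n / vec_poch \<eta> n))"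
      by (simp add: vec_poch_def) (simp add: mult_ac)
    also have "\<dots> = A n / vec_poch_multi h ps *
        (\<Sum>j\<le>n. if 2 * j \<le> n then g j / (4 ^ j * fact j * pochhammer (\<beta> + 1/2) j) / fact (n - 2 * j) else 0)"
      unfolding vec_poch_roots_ratio[OF Rnz assms(8) ok(2)] vec_poch_add_ratio(1)[OF lens(2) ok(3)]
        assms(3) poly_Rpoly_ratio[OF lens(1) ok(1,4) R0] g_def A_def by simp
    also have "\<dots> = (\<Sum>j\<le>n. if 2 * j \<le> n then c j * (A n / fact (n - 2 * j)) / vec_poch_multi h ps else 0)"
      unfolding sum_distrib_left c_def by (intro sum.cong refl) simp
    also have "\<dots> = (\<Sum>j\<le>T. if 2 * j \<le> n then c j * (A n / fact (n - 2 * j)) / vec_poch_multi h ps else 0)"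
      using n by (intro sum.mono_neutral_left) auto
    finally show "vec_poch ?as n / (vec_poch ?bs n * fact n) * poly 1 (of_nat n) * 2 ^ n =
        (\<Sum>j\<le>T. if 2 * j \<le> n then c j * (A n / fact (n - 2 * j)) / vec_poch_multi h ps else 0)" .
  qed
  also have "\<dots> = (\<Sum>j\<le>T. \<Sum>n\<le>T. if 2 * j \<le> n then c j * (A n / fact (n - 2 * j)) / vec_poch_multi h ps else 0)"
    by (rule sum.swap)
  also have "\<dots> = (\<Sum>j\<le>T. G * (vec_poch ?as' j / (vec_poch ?bs' j * fact j) * poly ?Y (of_nat j) * 1 ^ j))"
  proof (intro sum.cong refl)
    fix j
    have as': "vec_poch ?as' j = pochhammer \<alpha> (2 * j) * pochhammer d (2 * j) / 16 ^ j * vec_poch (vec_add f ms) j"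
      unfolding vec_poch_append pochhammer_Delta2 by (simp flip: power_mult_distrib)
    have bs': "vec_poch ?bs' j = pochhammer (\<beta> + 1/2) j * (pochhammer C (2 * j) / 4 ^ j) * vec_poch f j"
      unfolding vec_poch_append pochhammer_Delta2 by (simp add: vec_poch_def)
    have "(\<Sum>n\<le>T. if 2 * j \<le> n then c j * (A n / fact (n - 2 * j)) / vec_poch_multi h ps else 0) =
      (if 2 * j \<le> T then c j / vec_poch_multi h ps * (\<Sum>s\<le>T - 2 * j. A (2 * j + s) / fact s) else 0)"
      unfolding sum_shift_if sum_distrib_left by (simp add: mult.commute)
    also have "\<dots> = c j / vec_poch_multi h ps * (pochhammer \<alpha> (2 * j) * pochhammer d (2 * j) *
        (Gamma e * Gamma (e - \<alpha> - d) / Gamma (e - \<alpha>)) * poly ?Y (of_nat j) /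
      (pochhammer (1 + d + \<alpha> - e) p * pochhammer C (2 * j)))"
    proof (cases "2 * j \<le> T")
      case True
      have "(\<Sum>s\<le>T - 2 * j. A (2 * j + s) / fact s) =
        (\<Sum>s\<le>T - 2 * j. pochhammer \<alpha> (2 * j + s) * pochhammer d (2 * j + s) /
            (pochhammer e (2 * j + s) * fact s) * poly ?H (of_nat (2 * j + s)))"
        by (intro sum.cong refl) (simp add: A_def)
      then show ?thesis
        using True inner_sum_Ypoly[OF lens(2) assms(11,13,15) w T True assms(6)] by (simp only: C_def if_True)
    next
      \<comment> \<open>The inner sum is empty, and the closed form agrees because
        \<open>(\<alpha>)_{2j} (d)_{2j} = 0\<close>.\<close>
      case False
      then show ?thesis
        using vanish[of "2 * j"] by auto
    qed
    also have "\<dots> = G * (vec_poch ?as' j / (vec_poch ?bs' j * fact j) * poly ?Y (of_nat j) * 1 ^ j)"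
    proof -
      \<comment> \<open>The two upper Delta pairs give \<open>16^j\<close> in the denominator and
        the lower one gives \<open>4^j\<close> in the numerator; the remaining
        \<open>1 / 4^j\<close> is the one in \<open>c j\<close>.\<close>
      have "(16 :: complex) ^ j = 4 ^ j * 4 ^ j"
        by (simp flip: power_mult_distrib)
      then show ?thesis
        unfolding as' bs' by (simp add: G_def c_def g_def) (simp add: mult_ac)
    qed
    finally show "(\<Sum>n\<le>T. if 2 * j \<le> n then c j * (A n / fact (n - 2 * j)) / vec_poch_multi h ps else 0) =
        G * (vec_poch ?as' j / (vec_poch ?bs' j * fact j) * poly ?Y (of_nat j) * 1 ^ j)" .
  qed
  also have "\<dots> = G * hypF ?as' ?bs' ?Y 1"
  proof -
    have "vec_poch ?as' n = 0" if "n > T" for n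
      using vanish[of "2 * n"] that unfolding vec_poch_append pochhammer_Delta2 by auto
    then show ?thesis
      by (simp only: hypF_terminating[of T ?as'] sum_distrib_left)
  qed
  finally show ?thesis
    unfolding G_def C_def .
qed

end
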